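(* For each $p$, $1\le p\le\infty$, $KS^2[\mathbb{R}^n]\supset L^p[\mathbb{R}^n]$ as a dense subspace.
   Context: $\lambda_n$ is Lebesgue measure on $\mathbb{R}^n$. Enumerate the rational points as $\mathbb{Q}^n=\{\mathbf{x}_1,\mathbf{x}_2,\dots\}$. For $l,i\in\mathbb{N}$ let $\mathbf{B}_l(\mathbf{x}_i)$ be the closed cube centered at $\mathbf{x}_i$ with sides parallel to the coordinate axes and edge $e_l=\frac{1}{2^l\sqrt n}$. Using the natural bijection $\mathbb{N}\times\mathbb{N}\to\mathbb{N}$, list all these cubes as $\{\mathbf{B}_k:k\in\mathbb{N}\}$, and let $\mathcal{E}_k$ be the characteristic function of $\mathbf{B}_k$. Fix $t_k>0$ with $\sum_{k=1}^\infty t_k=1$. The Kuelbs–Steadman space $KS^2[\mathbb{R}^n]$ is the completion of $L^1[\mathbb{R}^n]$ with respect to the inner product $$(f,g)=\sum_{k=1}^\infty t_k\Big[\int_{\mathbb{R}^n}\mathcal{E}_k f\,d\lambda_n\Big]\overline{\Big[\int_{\mathbb{R}^n}\mathcal{E}_k g\,d\lambda_n\Big]}.$$ *)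

theory Defs
  imports "HOL-Analysis.Analysis"
begin

text \<open>
  Positive-integer indices are shifted to start at 0: the indices \<open>l\<close>, \<open>i\<close>, \<open>k\<close> below
  stand for \<open>l + 1\<close>, \<open>i + 1\<close>, \<open>k + 1\<close>. In particular the largest edge is \<open>1 / (2 * sqrt n)\<close>.
  Throughout, \<open>x\<close> is the enumeration of the rational points and \<open>t\<close> the sequence of weights.
\<close>

definition rational_points :: "(real ^ 'n) set" where
  "rational_points = {q. \<forall>i. q $ i \<in> \<rat>}"

definition ks_edge :: "'n::finite itself \<Rightarrow> nat \<Rightarrow> real" where
  "ks_edge _ l = 1 / (2 ^ Suc l * sqrt (real CARD('n)))"

definition ks_cube :: "nat \<Rightarrow> real ^ 'n \<Rightarrow> (real ^ 'n::finite) set" where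
  "ks_cube l c = cbox (c - vec (ks_edge TYPE('n) l / 2)) (c + vec (ks_edge TYPE('n) l / 2))"

text \<open>The cubes are listed as a single sequence by the Cantor pairing of \<open>(l, i)\<close>.\<close>

definition ks_cubes :: "(nat \<Rightarrow> real ^ 'n) \<Rightarrow> nat \<Rightarrow> (real ^ 'n::finite) set" where
  "ks_cubes x k = (case prod_decode k of (l, i) \<Rightarrow> ks_cube l (x i))"

text \<open>
  Functions representing the elements of \<open>L\<^sup>p\<close>; two of them represent the same element
  iff they agree almost everywhere.
\<close>

definition Lp :: "ennreal \<Rightarrow> (real ^ 'n::finite \<Rightarrow> complex) set" where
  "Lp p = {f \<in> borel_measurable lebesgue.
     if p = \<infinity> then \<exists>C. AE y in lebesgue. norm (f y) \<le> C
     else integrable lebesgue (\<lambda>y. norm (f y) powr enn2real p)}"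

definition ks_ip ::
    "(nat \<Rightarrow> real ^ 'n) \<Rightarrow> (nat \<Rightarrow> real) \<Rightarrow> (real ^ 'n::finite \<Rightarrow> complex) \<Rightarrow> (real ^ 'n \<Rightarrow> complex) \<Rightarrow> complex"
  where "ks_ip x t f g =
     (\<Sum>k. of_real (t k) * (LINT y|lebesgue. indicator (ks_cubes x k) y * f y)
            * cnj (LINT y|lebesgue. indicator (ks_cubes x k) y * g y))"

definition ks_norm ::
    "(nat \<Rightarrow> real ^ 'n) \<Rightarrow> (nat \<Rightarrow> real) \<Rightarrow> (real ^ 'n::finite \<Rightarrow> complex) \<Rightarrow> real" where
  "ks_norm x t f = sqrt (Re (ks_ip x t f f))"

text \<open>
  The completion of \<open>L\<^sup>1\<close> is built as the space of Cauchy sequences modulo null sequences.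
\<close>

definition ks_Cauchy ::
    "(nat \<Rightarrow> real ^ 'n) \<Rightarrow> (nat \<Rightarrow> real) \<Rightarrow> (nat \<Rightarrow> real ^ 'n::finite \<Rightarrow> complex) set" where
  "ks_Cauchy x t = {u. (\<forall>j. u j \<in> Lp 1) \<and>
     (\<forall>e>0. \<exists>N. \<forall>i\<ge>N. \<forall>j\<ge>N. ks_norm x t (\<lambda>y. u i y - u j y) < e)}"

definition ks_rel ::
    "(nat \<Rightarrow> real ^ 'n) \<Rightarrow> (nat \<Rightarrow> real) \<Rightarrow> (nat \<Rightarrow> real ^ 'n::finite \<Rightarrow> complex) rel" where
  "ks_rel x t = {(u, v). u \<in> ks_Cauchy x t \<and> v \<in> ks_Cauchy x t \<and>
     (\<lambda>j. ks_norm x t (\<lambda>y. u j y - v j y)) \<longlonglongrightarrow> 0}"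

definition KS2 ::
    "(nat \<Rightarrow> real ^ 'n) \<Rightarrow> (nat \<Rightarrow> real) \<Rightarrow> (nat \<Rightarrow> real ^ 'n::finite \<Rightarrow> complex) set set" where
  "KS2 x t = ks_Cauchy x t // ks_rel x t"

definition ks_zero ::
    "(nat \<Rightarrow> real ^ 'n) \<Rightarrow> (nat \<Rightarrow> real) \<Rightarrow> (nat \<Rightarrow> real ^ 'n::finite \<Rightarrow> complex) set" where
  "ks_zero x t = ks_rel x t `` {\<lambda>j y. 0}"

definition ks_add ::
    "(nat \<Rightarrow> real ^ 'n) \<Rightarrow> (nat \<Rightarrow> real) \<Rightarrow> (nat \<Rightarrow> real ^ 'n::finite \<Rightarrow> complex) set
      \<Rightarrow> (nat \<Rightarrow> real ^ 'n \<Rightarrow> complex) set \<Rightarrow> (nat \<Rightarrow> real ^ 'n \<Rightarrow> complex) set" where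
  "ks_add x t X Y = (\<Union>u\<in>X. \<Union>v\<in>Y. ks_rel x t `` {\<lambda>j y. u j y + v j y})"

definition ks_scale ::
    "(nat \<Rightarrow> real ^ 'n) \<Rightarrow> (nat \<Rightarrow> real) \<Rightarrow> complex \<Rightarrow> (nat \<Rightarrow> real ^ 'n::finite \<Rightarrow> complex) set
      \<Rightarrow> (nat \<Rightarrow> real ^ 'n \<Rightarrow> complex) set" where
  "ks_scale x t c X = (\<Union>u\<in>X. ks_rel x t `` {\<lambda>j y. c * u j y})"

definition KS2_ip ::
    "(nat \<Rightarrow> real ^ 'n) \<Rightarrow> (nat \<Rightarrow> real) \<Rightarrow> (nat \<Rightarrow> real ^ 'n::finite \<Rightarrow> complex) set
      \<Rightarrow> (nat \<Rightarrow> real ^ 'n \<Rightarrow> complex) set \<Rightarrow> complex" where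
  "KS2_ip x t X Y = (THE c. \<forall>u\<in>X. \<forall>v\<in>Y. (\<lambda>j. ks_ip x t (u j) (v j)) \<longlonglongrightarrow> c)"

definition KS2_dist ::
    "(nat \<Rightarrow> real ^ 'n) \<Rightarrow> (nat \<Rightarrow> real) \<Rightarrow> (nat \<Rightarrow> real ^ 'n::finite \<Rightarrow> complex) set
      \<Rightarrow> (nat \<Rightarrow> real ^ 'n \<Rightarrow> complex) set \<Rightarrow> real" where
  "KS2_dist x t X Y =
     (let D = ks_add x t X (ks_scale x t (-1) Y) in sqrt (Re (KS2_ip x t D D)))"

text \<open>The canonical map of \<open>L\<^sup>1\<close> into its completion.\<close>

definition ks_const ::
    "(nat \<Rightarrow> real ^ 'n) \<Rightarrow> (nat \<Rightarrow> real) \<Rightarrow> (real ^ 'n::finite \<Rightarrow> complex)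
      \<Rightarrow> (nat \<Rightarrow> real ^ 'n \<Rightarrow> complex) set" where
  "ks_const x t f = ks_rel x t `` {\<lambda>j. f}"

text \<open>
  The defining series of the inner product also makes sense for functions in \<open>L\<^sup>p\<close> that are
  not in \<open>L\<^sup>1\<close>. Such an \<open>f\<close> is identified with the class of all sequences of
  \<open>L\<^sup>1\<close> functions that converge to \<open>f\<close> in the norm given by this series. A priori this
  set could be empty, so that it lies in \<open>KS2\<close> is a genuine claim.
\<close>

definition ks_embed ::
    "(nat \<Rightarrow> real ^ 'n) \<Rightarrow> (nat \<Rightarrow> real) \<Rightarrow> (real ^ 'n::finite \<Rightarrow> complex)
      \<Rightarrow> (nat \<Rightarrow> real ^ 'n \<Rightarrow> complex) set" where
  "ks_embed x t f =
     {u \<in> ks_Cauchy x t. (\<lambda>j. ks_norm x t (\<lambda>y. u j y - f y)) \<longlonglongrightarrow> 0}"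

definition KS2_subspace ::
    "(nat \<Rightarrow> real ^ 'n) \<Rightarrow> (nat \<Rightarrow> real) \<Rightarrow> (nat \<Rightarrow> real ^ 'n::finite \<Rightarrow> complex) set set \<Rightarrow> bool" where
  "KS2_subspace x t S \<longleftrightarrow> S \<subseteq> KS2 x t \<and> ks_zero x t \<in> S \<and>
     (\<forall>X\<in>S. \<forall>Y\<in>S. ks_add x t X Y \<in> S) \<and> (\<forall>c. \<forall>X\<in>S. ks_scale x t c X \<in> S)"

definition KS2_dense ::
    "(nat \<Rightarrow> real ^ 'n) \<Rightarrow> (nat \<Rightarrow> real) \<Rightarrow> (nat \<Rightarrow> real ^ 'n::finite \<Rightarrow> complex) set set \<Rightarrow> bool" where
  "KS2_dense x t S \<longleftrightarrow> (\<forall>X\<in>KS2 x t. \<forall>e>0. \<exists>Y\<in>S. KS2_dist x t X Y < e)"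

end

theory Submission
  imports Defs
begin

text \<open>
  The Kuelbs--Steadman inner product sees a function \<open>f\<close> only through its coefficients
  \<open>ks_coef x f k\<close>, the integrals of \<open>f\<close> over the cubes: it is the inner product of the
  coefficient sequences in the \<open>\<ell>\<^sup>2\<close> space with weights \<open>t k\<close>. These weights have sum 1,
  so every bounded sequence is square summable. The statement follows from three observations.

  Every cube has measure at most 1, so the coefficients of \<open>f\<close> are bounded whenever
  \<open>f\<close> is the sum of an integrable and an essentially bounded function. Since
  \<open>\<bar>f\<bar> \<le> 1 + \<bar>f\<bar>\<^sup>p\<close>, all the spaces \<open>L\<^sup>p\<close> with \<open>p \<ge> 1\<close> lie in \<open>L1_plus_Linf\<close>, and
  it is enough to work with this one vector space, on which the inner product is a
  convergent series and defines a seminorm.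

  The seminorm vanishes exactly on the functions that are zero almost everywhere
  (\<open>AE_eq_0_if_ks_coef_eq_0\<close>). Indeed, the integral over a cube depends continuously on its
  centre, so if it vanishes for rational centres it vanishes for all of them, and Lebesgue
  differentiation along cubes of shrinking edge recovers \<open>f\<close>. Hence the
  embedding is injective modulo almost everywhere equality.

  Cutting \<open>f\<close> off where \<open>y\<close> or \<open>f y\<close> is large gives bounded functions of bounded support,
  which lie in every \<open>L\<^sup>p\<close> at once, and dominated convergence, first in each integral and then
  in the series over the cubes, shows that they converge to \<open>f\<close> in the seminorm
  (\<open>ks_dist_truncate_tendsto_0\<close>). For \<open>f\<close> in \<open>L\<^sup>p\<close> this is a sequence in \<open>L\<^sup>1\<close> that
  represents \<open>f\<close> in the completion; for \<open>f\<close> in \<open>L\<^sup>1\<close> it approximates \<open>f\<close> by elements of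
  \<open>L\<^sup>p\<close>, and as \<open>L\<^sup>1\<close> is dense in its completion, so is \<open>L\<^sup>p\<close>.

  What remains is the usual calculus of classes of Cauchy sequences: \<open>ks_embed x t f\<close> is the
  class of any sequence converging to \<open>f\<close>, sums and multiples can be formed on
  representatives, and the distance of two classes is the limit of the distances of their
  representatives.
\<close>

section \<open>Square summation against a probability weight\<close>

definition wip :: "(nat \<Rightarrow> real) \<Rightarrow> (nat \<Rightarrow> complex) \<Rightarrow> (nat \<Rightarrow> complex) \<Rightarrow> complex" where
  "wip t a b = (\<Sum>k. of_real (t k) * a k * cnj (b k))"

definition wnorm :: "(nat \<Rightarrow> real) \<Rightarrow> (nat \<Rightarrow> complex) \<Rightarrow> real" where
  "wnorm t a = sqrt (Re (wip t a a))"

locale prob_weight =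
  fixes t :: "nat \<Rightarrow> real"
  assumes t_pos: "\<And>k. t k > 0" and t_sums: "t sums 1"
begin

lemma wip_abs_summable:
  assumes "bounded (range a)" "bounded (range b)"
  shows "summable (\<lambda>k. norm (of_real (t k) * a k * cnj (b k)))"
proof -
  obtain A where A: "\<And>k. norm (a k) \<le> A"
    using assms(1) by (auto simp: bounded_iff)
  obtain B where B: "\<And>k. norm (b k) \<le> B"
    using assms(2) by (auto simp: bounded_iff)
  have "summable (\<lambda>k. t k * (A * B))"
    using t_sums by (intro summable_mult2) (auto simp: sums_iff)
  moreover have "norm (norm (of_real (t k) * a k * cnj (b k))) \<le> t k * (A * B)" for k
  proof -
    have "norm (a k) * norm (b k) \<le> A * B"
      using A[of k] B[of k] order_trans[OF norm_ge_zero A] by (intro mult_mono) auto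
    then show ?thesis
      using t_pos[of k] by (simp add: norm_mult mult.assoc)
  qed
  ultimately show ?thesis
    by (rule summable_comparison_test'[where N = 0])
qed

lemma wip_sums:
  assumes "bounded (range a)" "bounded (range b)"
  shows "(\<lambda>k. of_real (t k) * a k * cnj (b k)) sums wip t a b"
  unfolding wip_def using summable_norm_cancel[OF wip_abs_summable[OF assms]]
  by (rule summable_sums)

lemma wip_self_sums:
  assumes "bounded (range a)"
  shows "(\<lambda>k. t k * (norm (a k))\<^sup>2) sums Re (wip t a a)"
proof -
  have eq: "of_real (t k) * a k * cnj (a k) = of_real (t k * (norm (a k))\<^sup>2)" for k
    by (simp add: mult.assoc flip: complex_norm_square)
  show ?thesis
    using sums_Re[OF wip_sums[OF assms assms]] unfolding eq by simp
qed

lemma wip_self_nonneg: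
  assumes "bounded (range a)"
  shows "0 \<le> Re (wip t a a)"
  by (rule sums_le[OF _ sums_zero wip_self_sums[OF assms]]) (simp add: t_pos less_imp_le)

lemma wnorm_nonneg:
  assumes "bounded (range a)"
  shows "0 \<le> wnorm t a"
  using wip_self_nonneg[OF assms] by (simp add: wnorm_def)

lemma wip_self:
  assumes "bounded (range a)"
  shows "wip t a a = of_real ((wnorm t a)\<^sup>2)"
proof -
  have "of_real (t k) * a k * cnj (a k) = of_real (t k * (norm (a k))\<^sup>2)" for k
    by (simp add: mult.assoc flip: complex_norm_square)
  then have "(\<lambda>k. of_real (t k * (norm (a k))\<^sup>2)) sums wip t a a"
    using wip_sums[OF assms assms] by (simp only:)
  moreover have "(\<lambda>k. of_real (t k * (norm (a k))\<^sup>2)) sums complex_of_real (Re (wip t a a))"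
    using wip_self_sums[OF assms] by (rule sums_of_real)
  ultimately have "wip t a a = of_real (Re (wip t a a))"
    by (rule sums_unique2)
  then show ?thesis
    using wip_self_nonneg[OF assms] by (simp add: wnorm_def)
qed

lemma wnorm_eq_0_imp:
  assumes "bounded (range a)" "wnorm t a = 0"
  shows "a k = 0"
proof -
  have "(\<lambda>k. t k * (norm (a k))\<^sup>2) sums 0"
    using wip_self_sums[OF assms(1)] assms(2) by (simp add: wnorm_def)
  then have "t k * (norm (a k))\<^sup>2 = 0"
    using suminf_eq_zero_iff[of "\<lambda>k. t k * (norm (a k))\<^sup>2"] t_pos
    by (auto simp: sums_iff less_imp_le)
  then show ?thesis
    using t_pos[of k] by auto
qed

text \<open>The finite Euclidean norms bring the Minkowski and Cauchy--Schwarz inequalities to the limit.\<close>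

lemma L2_set_tendsto_wnorm:
  assumes "bounded (range a)"
  shows "(\<lambda>n. L2_set (\<lambda>k. sqrt (t k) * norm (a k)) {..<n}) \<longlonglongrightarrow> wnorm t a"
proof -
  have "(\<lambda>n. \<Sum>k<n. t k * (norm (a k))\<^sup>2) \<longlonglongrightarrow> Re (wip t a a)"
    using wip_self_sums[OF assms] by (simp add: sums_def)
  then have "(\<lambda>n. sqrt (\<Sum>k<n. t k * (norm (a k))\<^sup>2)) \<longlonglongrightarrow> wnorm t a"
    unfolding wnorm_def by (rule tendsto_real_sqrt)
  then show ?thesis
    using t_pos by (simp add: L2_set_def power_mult_distrib less_imp_le)
qed

lemma wip_Cauchy_Schwarz:
  assumes "bounded (range a)" "bounded (range b)"
  shows "norm (wip t a b) \<le> wnorm t a * wnorm t b"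
proof (rule LIMSEQ_le)
  show "(\<lambda>n. norm (\<Sum>k<n. of_real (t k) * a k * cnj (b k))) \<longlonglongrightarrow> norm (wip t a b)"
    using wip_sums[OF assms] by (auto simp: sums_def intro: tendsto_norm)
  show "(\<lambda>n. L2_set (\<lambda>k. sqrt (t k) * norm (a k)) {..<n} * L2_set (\<lambda>k. sqrt (t k) * norm (b k)) {..<n})
      \<longlonglongrightarrow> wnorm t a * wnorm t b"
    using assms by (intro tendsto_mult L2_set_tendsto_wnorm)
  have "norm (\<Sum>k<n. of_real (t k) * a k * cnj (b k))
      \<le> L2_set (\<lambda>k. sqrt (t k) * norm (a k)) {..<n} * L2_set (\<lambda>k. sqrt (t k) * norm (b k)) {..<n}" for n
  proof -
    have "norm (of_real (t k) * a k * cnj (b k))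
        = \<bar>sqrt (t k) * norm (a k)\<bar> * \<bar>sqrt (t k) * norm (b k)\<bar>" for k
    proof -
      have "norm (of_real (t k) * a k * cnj (b k)) = (sqrt (t k) * sqrt (t k)) * norm (a k) * norm (b k)"
        using t_pos[of k] by (simp add: norm_mult)
      then show ?thesis
        using t_pos[of k] by (simp add: abs_mult mult_ac)
    qed
    then have "norm (\<Sum>k<n. of_real (t k) * a k * cnj (b k))
        \<le> (\<Sum>k<n. \<bar>sqrt (t k) * norm (a k)\<bar> * \<bar>sqrt (t k) * norm (b k)\<bar>)"
      using sum_norm_le by (metis (no_types, lifting) order_refl)
    also have "\<dots> \<le> L2_set (\<lambda>k. sqrt (t k) * norm (a k)) {..<n} * L2_set (\<lambda>k. sqrt (t k) * norm (b k)) {..<n}"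
      by (rule L2_set_mult_ineq)
    finally show ?thesis .
  qed
  then show "\<exists>N. \<forall>n\<ge>N. norm (\<Sum>k<n. of_real (t k) * a k * cnj (b k))
      \<le> L2_set (\<lambda>k. sqrt (t k) * norm (a k)) {..<n} * L2_set (\<lambda>k. sqrt (t k) * norm (b k)) {..<n}"
    by blast
qed

lemma wnorm_triangle:
  assumes "bounded (range a)" "bounded (range b)"
  shows "wnorm t (\<lambda>k. a k + b k) \<le> wnorm t a + wnorm t b"
proof (rule LIMSEQ_le)
  show "(\<lambda>n. L2_set (\<lambda>k. sqrt (t k) * norm (a k + b k)) {..<n}) \<longlonglongrightarrow> wnorm t (\<lambda>k. a k + b k)"
    using assms by (intro L2_set_tendsto_wnorm bounded_plus_comp)
  show "(\<lambda>n. L2_set (\<lambda>k. sqrt (t k) * norm (a k)) {..<n} + L2_set (\<lambda>k. sqrt (t k) * norm (b k)) {..<n})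
      \<longlonglongrightarrow> wnorm t a + wnorm t b"
    using assms by (intro tendsto_add L2_set_tendsto_wnorm)
  have "L2_set (\<lambda>k. sqrt (t k) * norm (a k + b k)) {..<n}
      \<le> L2_set (\<lambda>k. sqrt (t k) * norm (a k)) {..<n} + L2_set (\<lambda>k. sqrt (t k) * norm (b k)) {..<n}" for n
  proof -
    have "L2_set (\<lambda>k. sqrt (t k) * norm (a k + b k)) {..<n}
        \<le> L2_set (\<lambda>k. sqrt (t k) * norm (a k) + sqrt (t k) * norm (b k)) {..<n}"
      using t_pos by (intro L2_set_mono)
        (auto simp: less_imp_le norm_triangle_ineq simp flip: distrib_left intro!: mult_left_mono)
    also have "\<dots> \<le> L2_set (\<lambda>k. sqrt (t k) * norm (a k)) {..<n} + L2_set (\<lambda>k. sqrt (t k) * norm (b k)) {..<n}"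
      by (rule L2_set_triangle_ineq)
    finally show ?thesis .
  qed
  then show "\<exists>N. \<forall>n\<ge>N. L2_set (\<lambda>k. sqrt (t k) * norm (a k + b k)) {..<n}
      \<le> L2_set (\<lambda>k. sqrt (t k) * norm (a k)) {..<n} + L2_set (\<lambda>k. sqrt (t k) * norm (b k)) {..<n}"
    by blast
qed

lemma wnorm_scale:
  assumes "bounded (range a)"
  shows "wnorm t (\<lambda>k. c * a k) = norm c * wnorm t a"
proof -
  have "bounded (range (\<lambda>k. c * a k))"
    using bounded_linear_image[OF assms bounded_linear_mult_right[of c]] by (simp add: image_image)
  from wip_self_sums[OF this]
  have "(\<lambda>k. (norm c)\<^sup>2 * (t k * (norm (a k))\<^sup>2)) sums Re (wip t (\<lambda>k. c * a k) (\<lambda>k. c * a k))"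
    by (simp add: norm_mult power_mult_distrib mult_ac)
  moreover have "(\<lambda>k. (norm c)\<^sup>2 * (t k * (norm (a k))\<^sup>2)) sums ((norm c)\<^sup>2 * Re (wip t a a))"
    by (intro sums_mult wip_self_sums assms)
  ultimately have "Re (wip t (\<lambda>k. c * a k) (\<lambda>k. c * a k)) = (norm c)\<^sup>2 * Re (wip t a a)"
    by (rule sums_unique2)
  then show ?thesis
    by (simp add: wnorm_def real_sqrt_mult)
qed

lemma wip_diff_right:
  assumes "bounded (range a)" "bounded (range b)" "bounded (range c)"
  shows "wip t a (\<lambda>k. b k - c k) = wip t a b - wip t a c"
proof -
  have "(\<lambda>k. of_real (t k) * a k * cnj (b k - c k)) sums (wip t a b - wip t a c)"
    using sums_diff[OF wip_sums[OF assms(1,2)] wip_sums[OF assms(1,3)]]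
    by (simp add: algebra_simps)
  then show ?thesis
    by (simp add: wip_def sums_iff)
qed

text \<open>
  Dominated convergence for series: the weights times a constant form a summable majorant.
\<close>

lemma wnorm_tendsto_0:
  assumes lim: "\<And>k. (\<lambda>j. a j k) \<longlonglongrightarrow> 0" and bound: "\<And>j k. norm (a j k) \<le> C"
  shows "(\<lambda>j. wnorm t (a j)) \<longlonglongrightarrow> 0"
proof -
  have "(\<lambda>j. \<Sum>k. t k * (norm (a j k))\<^sup>2) \<longlonglongrightarrow> (\<Sum>k. t k * (norm (0::complex))\<^sup>2)"
  proof (rule tannerys_theorem[THEN conjunct2, THEN conjunct2])
    show "(\<lambda>j. t k * (norm (a j k))\<^sup>2) \<longlonglongrightarrow> t k * (norm (0::complex))\<^sup>2" for k
      by (intro tendsto_intros lim)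
    show "summable (\<lambda>k. t k * C\<^sup>2)"
      using t_sums by (intro summable_mult2) (auto simp: sums_iff)
    have "norm (t k * (norm (a j k))\<^sup>2) \<le> t k * C\<^sup>2" for k j
      using t_pos[of k] bound[of j k]
      by (auto simp: abs_mult less_imp_le intro!: mult_left_mono power_mono)
    then show "\<forall>\<^sub>F (k, j) in sequentially \<times>\<^sub>F sequentially.
        norm (t k * (norm (a j k))\<^sup>2) \<le> t k * C\<^sup>2"
      by (intro always_eventually) auto
  qed auto
  then have "(\<lambda>j. sqrt (\<Sum>k. t k * (norm (a j k))\<^sup>2)) \<longlonglongrightarrow> sqrt 0"
    by (intro tendsto_real_sqrt) simp
  moreover have "sqrt (\<Sum>k. t k * (norm (a j k))\<^sup>2) = wnorm t (a j)" for j
  proof -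
    have "bounded (range (a j))"
      using bound by (auto simp: bounded_iff)
    then show ?thesis
      using wip_self_sums by (simp add: wnorm_def sums_iff)
  qed
  ultimately show ?thesis
    by simp
qed

end

section \<open>The sum of the integrable and the bounded functions\<close>

text \<open>
  The space \<open>L\<^sup>1 + L\<^sup>\<infinity>\<close>, described by a pointwise majorant \<open>C + h\<close> instead of a decomposition
  of \<open>f\<close>. It contains every \<open>L\<^sup>p\<close> with \<open>p \<ge> 1\<close>, and a single bound holds for the integrals of
  \<open>\<bar>f\<bar>\<close> over all sets of measure at most 1.
\<close>

definition L1_plus_Linf :: "(real ^ 'n::finite \<Rightarrow> complex) set" where
  "L1_plus_Linf = {f \<in> borel_measurable lebesgue.
     \<exists>h C. integrable lebesgue h \<and> (AE y in lebesgue. norm (f y) \<le> C + (h y :: real))}"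

lemma L1_plus_LinfI:
  assumes "f \<in> borel_measurable lebesgue" "integrable lebesgue h"
    "AE y in lebesgue. norm (f y) \<le> C + (h y :: real)"
  shows "f \<in> L1_plus_Linf"
  using assms by (auto simp: L1_plus_Linf_def)

lemma L1_plus_Linf_measurable [measurable_dest]:
  "f \<in> L1_plus_Linf \<Longrightarrow> f \<in> borel_measurable lebesgue"
  by (simp add: L1_plus_Linf_def)

lemma L1_plus_Linf_add:
  assumes "f \<in> L1_plus_Linf" "g \<in> L1_plus_Linf"
  shows "(\<lambda>y. f y + g y) \<in> L1_plus_Linf"
proof -
  obtain h C where h: "integrable lebesgue h" "AE y in lebesgue. norm (f y) \<le> C + (h y :: real)"
    using assms(1) by (auto simp: L1_plus_Linf_def)
  obtain h' C' where h': "integrable lebesgue h'" "AE y in lebesgue. norm (g y) \<le> C' + (h' y :: real)"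
    using assms(2) by (auto simp: L1_plus_Linf_def)
  show ?thesis
  proof (rule L1_plus_LinfI)
    show "integrable lebesgue (\<lambda>y. h y + h' y)"
      using h(1) h'(1) by simp
    show "AE y in lebesgue. norm (f y + g y) \<le> (C + C') + (h y + h' y)"
      using h(2) h'(2)
    proof eventually_elim
      case (elim y)
      then show ?case
        using norm_triangle_ineq[of "f y" "g y"] by linarith
    qed
  qed (use assms in \<open>auto dest: L1_plus_Linf_measurable\<close>)
qed

lemma L1_plus_Linf_scale:
  assumes "f \<in> L1_plus_Linf"
  shows "(\<lambda>y. c * f y) \<in> L1_plus_Linf"
proof -
  obtain h C where h: "integrable lebesgue h" "AE y in lebesgue. norm (f y) \<le> C + (h y :: real)"
    using assms(1) by (auto simp: L1_plus_Linf_def)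
  show ?thesis
  proof (rule L1_plus_LinfI)
    show "integrable lebesgue (\<lambda>y. norm c * h y)"
      using h(1) by simp
    show "AE y in lebesgue. norm (c * f y) \<le> norm c * C + norm c * h y"
      using h(2)
    proof eventually_elim
      case (elim y)
      then show ?case
        by (simp add: norm_mult mult_left_mono flip: distrib_left)
    qed
  qed (use assms in \<open>auto dest: L1_plus_Linf_measurable\<close>)
qed

lemma L1_plus_Linf_diff:
  assumes "f \<in> L1_plus_Linf" "g \<in> L1_plus_Linf"
  shows "(\<lambda>y. f y - g y) \<in> L1_plus_Linf"
  using L1_plus_Linf_add[OF assms(1) L1_plus_Linf_scale[OF assms(2), of "-1"]] by simp

lemma L1_plus_Linf_set_integrable:
  assumes f: "f \<in> L1_plus_Linf" and S: "S \<in> lmeasurable"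
  shows "set_integrable lebesgue S f"
proof -
  obtain h C where h: "integrable lebesgue h" "AE y in lebesgue. norm (f y) \<le> C + (h y :: real)"
    using f by (auto simp: L1_plus_Linf_def)
  have "set_integrable lebesgue S (\<lambda>y. C + h y)"
  proof (rule set_integral_add(1))
    show "set_integrable lebesgue S (\<lambda>y. C)"
      using S unfolding set_integrable_def by (auto simp: fmeasurable_def)
    show "set_integrable lebesgue S h"
      using h(1) S unfolding set_integrable_def by (intro integrable_mult_indicator) auto
  qed
  then show ?thesis
  proof (rule set_integrable_bound)
    show "set_borel_measurable lebesgue S f"
      using f S unfolding set_borel_measurable_def
      by (intro borel_measurable_scaleR) (auto dest: L1_plus_Linf_measurable)
    show "AE y in lebesgue. y \<in> S \<longrightarrow> norm (f y) \<le> norm (C + h y)"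
      using h(2) by eventually_elim auto
  qed
qed

lemma L1_plus_Linf_integral_bound:
  assumes f: "f \<in> L1_plus_Linf"
  obtains C where "\<And>S. S \<in> lmeasurable \<Longrightarrow> measure lebesgue S \<le> 1 \<Longrightarrow>
    (LINT y:S|lebesgue. norm (f y)) \<le> C"
proof -
  obtain h C where h: "integrable lebesgue h" "AE y in lebesgue. norm (f y) \<le> C + (h y :: real)"
    using f by (auto simp: L1_plus_Linf_def)
  have "(LINT y:S|lebesgue. norm (f y)) \<le> \<bar>C\<bar> + (LINT y|lebesgue. \<bar>h y\<bar>)"
    if S: "S \<in> lmeasurable" and le: "measure lebesgue S \<le> 1" for S
  proof -
    have intC: "set_integrable lebesgue S (\<lambda>y. \<bar>C\<bar>)"
      using S unfolding set_integrable_def by (auto simp: fmeasurable_def)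
    have inth: "set_integrable lebesgue S (\<lambda>y. \<bar>h y\<bar>)"
      using h(1) S unfolding set_integrable_def by (intro integrable_mult_indicator) auto
    have "(LINT y:S|lebesgue. norm (f y)) \<le> (LINT y:S|lebesgue. \<bar>C\<bar> + \<bar>h y\<bar>)"
    proof (rule set_integral_mono_AE)
      show "set_integrable lebesgue S (\<lambda>y. norm (f y))"
        using L1_plus_Linf_set_integrable[OF f S] by (rule set_integrable_norm)
      show "AE y\<in>S in lebesgue. norm (f y) \<le> \<bar>C\<bar> + \<bar>h y\<bar>"
        using h(2) by eventually_elim auto
    qed (use intC inth in simp)
    also have "\<dots> = (LINT y:S|lebesgue. \<bar>C\<bar>) + (LINT y:S|lebesgue. \<bar>h y\<bar>)"
      using intC inth by simp
    also have "(LINT y:S|lebesgue. \<bar>C\<bar>) = measure lebesgue S * \<bar>C\<bar>"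
      using S by (simp add: set_lebesgue_integral_def)
    also have "\<dots> \<le> \<bar>C\<bar>"
      using mult_right_mono[OF le, of "\<bar>C\<bar>"] by simp
    also have "(LINT y:S|lebesgue. \<bar>h y\<bar>) \<le> (LINT y|lebesgue. \<bar>h y\<bar>)"
      unfolding set_lebesgue_integral_def
      using inth h(1) by (intro integral_mono) (auto simp: set_integrable_def split: split_indicator)
    finally show ?thesis by simp
  qed
  then show ?thesis
    using that by blast
qed

text \<open>
  For finite \<open>p\<close> the majorant is \<open>1 + \<bar>f\<bar>\<^sup>p\<close>: where \<open>\<bar>f\<bar> > 1\<close>, the power dominates \<open>\<bar>f\<bar>\<close>
  because the exponent is at least 1.
\<close>

lemma Lp_subset_L1_plus_Linf:
  assumes "1 \<le> p"
  shows "Lp p \<subseteq> L1_plus_Linf"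
proof
  fix f :: "real ^ 'n \<Rightarrow> complex"
  assume f: "f \<in> Lp p"
  show "f \<in> L1_plus_Linf"
  proof (cases "p = \<infinity>")
    case True
    then obtain C where "AE y in lebesgue. norm (f y) \<le> C"
      using f by (auto simp: Lp_def)
    then show ?thesis
      using f by (intro L1_plus_LinfI[where h = "\<lambda>_. 0"]) (auto simp: Lp_def)
  next
    case False
    let ?P = "enn2real p"
    have P: "1 \<le> ?P"
      using assms False enn2real_mono[of 1 p] by (simp add: less_top)
    show ?thesis
    proof (rule L1_plus_LinfI)
      show "integrable lebesgue (\<lambda>y. norm (f y) powr ?P)"
        using f False by (simp add: Lp_def)
      have "norm (f y) \<le> 1 + norm (f y) powr ?P" for y
      proof (cases "norm (f y) \<le> 1")
        case True
        then show ?thesis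
          using powr_ge_zero[of "norm (f y)" ?P] by linarith
      next
        case False
        then show ?thesis
          using powr_mono[OF P, of "norm (f y)"] by simp
      qed
      then show "AE y in lebesgue. norm (f y) \<le> 1 + norm (f y) powr ?P"
        by simp
    qed (use f in \<open>simp add: Lp_def\<close>)
  qed
qed

lemma Lp_add:
  assumes "1 \<le> p" and f: "f \<in> Lp p" and g: "g \<in> Lp p"
  shows "(\<lambda>y. f y + g y) \<in> Lp p"
proof (cases "p = \<infinity>")
  case True
  then obtain C D where "AE y in lebesgue. norm (f y) \<le> C" "AE y in lebesgue. norm (g y) \<le> D"
    using f g by (auto simp: Lp_def)
  then have "AE y in lebesgue. norm (f y + g y) \<le> C + D"
  proof eventually_elim
    case (elim y)
    then show ?case using norm_triangle_ineq[of "f y" "g y"] by linarith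
  qed
  then show ?thesis
    using True f g by (auto simp: Lp_def)
next
  case False
  let ?P = "enn2real p"
  have [measurable]: "f \<in> borel_measurable lebesgue" "g \<in> borel_measurable lebesgue"
    using f g by (auto simp: Lp_def)
  have bound: "norm (f y + g y) powr ?P \<le> 2 powr ?P * (norm (f y) powr ?P + norm (g y) powr ?P)" for y
  proof -
    \<comment> \<open>The sum is at most twice the larger of the two moduli.\<close>
    let ?M = "max (norm (f y)) (norm (g y))"
    have "norm (f y + g y) powr ?P \<le> (2 * ?M) powr ?P"
      using norm_triangle_ineq[of "f y" "g y"] by (intro powr_mono2) auto
    also have "\<dots> = 2 powr ?P * ?M powr ?P"
      by (simp add: powr_mult)
    also have "\<dots> \<le> 2 powr ?P * (norm (f y) powr ?P + norm (g y) powr ?P)"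
      by (intro mult_left_mono) (auto simp: max_def)
    finally show ?thesis .
  qed
  have "integrable lebesgue (\<lambda>y. norm (f y + g y) powr ?P)"
  proof (rule Bochner_Integration.integrable_bound)
    show "integrable lebesgue (\<lambda>y. 2 powr ?P * (norm (f y) powr ?P + norm (g y) powr ?P))"
      using f g False by (simp add: Lp_def)
    show "AE y in lebesgue. norm (norm (f y + g y) powr ?P)
        \<le> norm (2 powr ?P * (norm (f y) powr ?P + norm (g y) powr ?P))"
      using bound by simp
  qed measurable
  then show ?thesis
    using False by (simp add: Lp_def)
qed

lemma Lp_scale:
  assumes f: "f \<in> Lp p"
  shows "(\<lambda>y. c * f y) \<in> Lp p"
proof (cases "p = \<infinity>")
  case True
  then obtain C where "AE y in lebesgue. norm (f y) \<le> C"
    using f by (auto simp: Lp_def)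
  then have "AE y in lebesgue. norm (c * f y) \<le> norm c * C"
    by eventually_elim (simp add: norm_mult mult_left_mono)
  then show ?thesis
    using True f by (auto simp: Lp_def)
next
  case False
  then show ?thesis
    using f by (auto simp: Lp_def norm_mult powr_mult)
qed

lemma Lp_zero: "(\<lambda>y. 0) \<in> Lp p"
  by (auto simp: Lp_def)

definition truncate :: "nat \<Rightarrow> (real ^ 'n::finite \<Rightarrow> complex) \<Rightarrow> real ^ 'n \<Rightarrow> complex" where
  "truncate j f y = (if norm y \<le> real j \<and> norm (f y) \<le> real j then f y else 0)"

lemma truncate_measurable:
  fixes f :: "real ^ 'n::finite \<Rightarrow> complex"
  assumes [measurable]: "f \<in> borel_measurable lebesgue"
  shows "truncate j f \<in> borel_measurable lebesgue"
proof -
  have [measurable]: "(\<lambda>y. y) \<in> borel_measurable (lebesgue :: (real ^ 'n) measure)"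
    by (simp add: measurable_completion)
  show ?thesis
    unfolding truncate_def[abs_def] by measurable
qed

text \<open>
  A bounded function of bounded support lies in every \<open>L\<^sup>p\<close>, so one and the same truncation
  links \<open>L\<^sup>1\<close> with \<open>L\<^sup>p\<close> for all exponents.
\<close>

lemma truncate_in_Lp:
  fixes f :: "real ^ 'n::finite \<Rightarrow> complex"
  assumes f: "f \<in> borel_measurable lebesgue"
  shows "truncate j f \<in> Lp p"
proof (cases "p = \<infinity>")
  case True
  have "AE y in lebesgue. norm (truncate j f y) \<le> real j"
    by (simp add: truncate_def)
  then show ?thesis
    using True truncate_measurable[OF f] by (auto simp: Lp_def)
next
  case False
  note [measurable] = truncate_measurable[OF f]
  have "integrable lebesgue (\<lambda>y. norm (truncate j f y) powr enn2real p)"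
  proof (rule integrableI_bounded_set)
    show "cball 0 (real j) \<in> sets (lebesgue :: (real ^ 'n) measure)"
      by simp
    show "emeasure lebesgue (cball (0 :: real ^ 'n) (real j)) < \<infinity>"
      using lmeasurable_cball by (auto simp: fmeasurable_def)
    show "AE y in lebesgue. y \<in> cball 0 (real j) \<longrightarrow>
        norm (norm (truncate j f y) powr enn2real p) \<le> real j powr enn2real p"
      by (intro AE_I2) (auto simp: truncate_def intro!: powr_mono2)
    show "AE y in lebesgue. y \<notin> cball 0 (real j) \<longrightarrow> norm (truncate j f y) powr enn2real p = 0"
      by (auto simp: truncate_def)
  qed measurable
  then show ?thesis
    using False truncate_measurable[OF f] by (simp add: Lp_def)
qed

lemma norm_truncate_diff_le: "norm (truncate j f y - f y) \<le> norm (f y)"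
  by (simp add: truncate_def)

lemma truncate_diff_tendsto_0: "(\<lambda>j. truncate j f y - f y) \<longlonglongrightarrow> 0"
proof (rule tendsto_eventually)
  obtain n where n: "max (norm y) (norm (f y)) \<le> real n"
    using real_arch_simple by blast
  show "\<forall>\<^sub>F j in sequentially. truncate j f y - f y = 0"
    using eventually_ge_at_top[of n]
  proof eventually_elim
    case (elim j)
    then have "real n \<le> real j" by simp
    then have "norm y \<le> real j \<and> norm (f y) \<le> real j"
      using n by (auto simp: max_def split: if_splits)
    then show ?case by (simp add: truncate_def)
  qed
qed

section \<open>The integrals over the cubes determine the function\<close>

lemma ks_edge_pos: "0 < ks_edge TYPE('n::finite) l"
  by (simp add: ks_edge_def)

lemma ks_edge_le: "ks_edge TYPE('n::finite) l \<le> (1 / 2) ^ Suc l"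
proof -
  have "1 \<le> real CARD('n)"
    using one_le_card_finite[where 'a = 'n] by simp
  then have "1 \<le> sqrt (real CARD('n))"
    by simp
  then have "2 ^ Suc l * 1 \<le> 2 ^ Suc l * sqrt (real CARD('n))"
    by (intro mult_left_mono) auto
  then show ?thesis
    unfolding ks_edge_def power_one_over by (intro divide_left_mono) auto
qed

lemma ks_edge_tendsto_0: "(\<lambda>l. ks_edge TYPE('n::finite) l) \<longlonglongrightarrow> 0"
proof (rule real_tendsto_sandwich)
  show "\<forall>\<^sub>F l in sequentially. 0 \<le> ks_edge TYPE('n) l"
    by (simp add: less_imp_le[OF ks_edge_pos])
  show "\<forall>\<^sub>F l in sequentially. ks_edge TYPE('n) l \<le> (1 / 2) ^ Suc l"
    by (intro always_eventually allI ks_edge_le)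
  show "(\<lambda>l. (1 / 2 :: real) ^ Suc l) \<longlonglongrightarrow> 0"
    using LIMSEQ_power_zero[of "1 / 2 :: real"] by (intro LIMSEQ_Suc) simp
qed simp

lemma ks_cube_lmeasurable: "ks_cube l c \<in> lmeasurable"
  by (simp add: ks_cube_def)

text \<open>
  The edge is at most 1/2, hence so is every factor of the volume, in any dimension.
\<close>

lemma measure_ks_cube_le: "measure lebesgue (ks_cube l (c :: real ^ 'n::finite)) \<le> 1"
proof -
  let ?e = "ks_edge TYPE('n) l"
  have le: "c $ i - ?e / 2 \<le> c $ i + ?e / 2" for i
    using ks_edge_pos[where 'n = 'n, of l] by simp
  then have ne: "ks_cube l c \<noteq> {}"
    by (auto simp: ks_cube_def interval_ne_empty_cart)
  have "measure lebesgue (ks_cube l c) = (\<Prod>i\<in>(UNIV :: 'n set). ?e)"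
    using ne unfolding ks_cube_def by (simp add: content_cbox_cart)
  also have "\<dots> \<le> 1"
  proof (rule prod_le_1)
    have "?e \<le> (1 / 2) ^ Suc l"
      by (rule ks_edge_le)
    also have "\<dots> \<le> 1"
      by (rule power_le_one) auto
    finally show "0 \<le> ?e \<and> ?e \<le> 1" for i :: 'n
      using ks_edge_pos[where 'n = 'n, of l] by simp
  qed
  finally show ?thesis .
qed

lemma ks_cubes_eq: "ks_cubes x k = ks_cube (fst (prod_decode k)) (x (snd (prod_decode k)))"
  by (simp add: ks_cubes_def case_prod_beta)

lemma ks_cubes_lmeasurable: "ks_cubes x k \<in> lmeasurable"
  by (simp add: ks_cubes_eq ks_cube_lmeasurable)

lemma measure_ks_cubes_le: "measure lebesgue (ks_cubes x k) \<le> 1"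
  by (simp add: ks_cubes_eq measure_ks_cube_le)

definition ks_coef ::
    "(nat \<Rightarrow> real ^ 'n) \<Rightarrow> (real ^ 'n::finite \<Rightarrow> complex) \<Rightarrow> nat \<Rightarrow> complex" where
  "ks_coef x f k = (LINT y|lebesgue. indicator (ks_cubes x k) y * f y)"

lemma ks_coef_eq: "ks_coef x f k = (LINT y:ks_cubes x k|lebesgue. f y)"
  unfolding ks_coef_def set_lebesgue_integral_def
  by (intro Bochner_Integration.integral_cong) (auto simp: indicator_def)

lemma ks_ip_eq: "ks_ip x t f g = wip t (ks_coef x f) (ks_coef x g)"
  by (simp add: ks_ip_def wip_def ks_coef_def)

lemma ks_norm_eq: "ks_norm x t f = wnorm t (ks_coef x f)"
  by (simp add: ks_norm_def wnorm_def ks_ip_eq)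

lemmas ks_set_integrable = L1_plus_Linf_set_integrable[OF _ ks_cubes_lmeasurable]

lemma ks_coef_add:
  "f \<in> L1_plus_Linf \<Longrightarrow> g \<in> L1_plus_Linf \<Longrightarrow>
    ks_coef x (\<lambda>y. f y + g y) = (\<lambda>k. ks_coef x f k + ks_coef x g k)"
  by (auto simp: ks_coef_eq ks_set_integrable)

lemma ks_coef_diff:
  "f \<in> L1_plus_Linf \<Longrightarrow> g \<in> L1_plus_Linf \<Longrightarrow>
    ks_coef x (\<lambda>y. f y - g y) = (\<lambda>k. ks_coef x f k - ks_coef x g k)"
  by (auto simp: ks_coef_eq ks_set_integrable)

lemma ks_coef_scale: "ks_coef x (\<lambda>y. c * f y) = (\<lambda>k. c * ks_coef x f k)"
  by (auto simp: ks_coef_eq)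

lemma norm_ks_coef_le:
  assumes "f \<in> L1_plus_Linf"
  shows "norm (ks_coef x f k) \<le> (LINT y:ks_cubes x k|lebesgue. norm (f y))"
  unfolding ks_coef_eq by (rule set_integral_norm_bound[OF ks_set_integrable[OF assms]])

lemma bounded_ks_coef:
  assumes "f \<in> L1_plus_Linf"
  shows "bounded (range (ks_coef x f))"
proof -
  obtain C where C: "\<And>S. S \<in> lmeasurable \<Longrightarrow> measure lebesgue S \<le> 1 \<Longrightarrow>
    (LINT y:S|lebesgue. norm (f y)) \<le> C"
    using L1_plus_Linf_integral_bound[OF assms] by blast
  have "norm (ks_coef x f k) \<le> C" for k
    using norm_ks_coef_le[OF assms] C[OF ks_cubes_lmeasurable measure_ks_cubes_le] by (rule order_trans)
  then show ?thesis
    by (auto simp: bounded_iff)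
qed

lemma closure_rational_points: "closure (rational_points :: (real ^ 'n::finite) set) = UNIV"
proof -
  have "(\<Union>f \<in> Basis \<rightarrow> \<rat>. {\<Sum>i :: real ^ 'n \<in> Basis. f i *\<^sub>R i}) \<subseteq> rational_points"
  proof clarify
    fix f :: "real ^ 'n \<Rightarrow> real"
    assume f: "f \<in> Basis \<rightarrow> \<rat>"
    have "(\<Sum>i\<in>Basis. f i *\<^sub>R i) $ j = f (axis j 1)" for j
      by (simp add: cart_eq_inner_axis inner_sum_left_Basis)
    then show "(\<Sum>i\<in>Basis. f i *\<^sub>R i) \<in> rational_points"
      using f by (auto simp: rational_points_def)
  qed
  then show ?thesis
    using closure_rational_coordinates[where 'a = "real ^ 'n"] closure_mono by blast
qed

text \<open>
  The integral of a locally integrable function over a box is continuous in the corners of the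
  box. The cubes of a fixed edge with rational centres are therefore dense enough to
  control all cubes of that edge.
\<close>

lemma ks_cube_integral_eq_0:
  fixes f :: "real ^ 'n::finite \<Rightarrow> complex"
  assumes x: "range x = rational_points" and f: "f \<in> L1_plus_Linf"
    and zero: "\<And>k. ks_coef x f k = 0"
  shows "integral (ks_cube l c) f = 0"
proof (rule ccontr)
  assume nz: "integral (ks_cube l c) f \<noteq> 0"
  let ?r = "ks_edge TYPE('n) l / 2"
  \<comment> \<open>A box that contains the cube around every centre at distance at most 1 from \<open>c\<close>.\<close>
  let ?a = "c - vec (?r + 1)" and ?b = "c + vec (?r + 1)"
  have r: "0 < ?r"
    using ks_edge_pos by simp
  have "f integrable_on cbox ?a ?b"
    using L1_plus_Linf_set_integrable[OF f lmeasurable_cbox] by (rule set_lebesgue_integral_eq_integral)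
  moreover have "c - vec ?r \<in> cbox ?a ?b" "c + vec ?r \<in> cbox ?a ?b"
    using r by (auto simp: mem_box_cart)
  ultimately obtain \<delta> where \<delta>: "0 < \<delta>"
    "\<And>c' d'. \<lbrakk>c' \<in> cbox ?a ?b; d' \<in> cbox ?a ?b; norm (c' - (c - vec ?r)) \<le> \<delta>;
        norm (d' - (c + vec ?r)) \<le> \<delta>\<rbrakk>
      \<Longrightarrow> norm (integral (cbox c' d') f - integral (cbox (c - vec ?r) (c + vec ?r)) f)
            < norm (integral (ks_cube l c) f)"
    using nz by (auto intro: indefinite_integral_continuous[of f ?a ?b _ _ "norm (integral (ks_cube l c) f)"])
  have "c \<in> closure (range x)"
    using closure_rational_points x by auto
  then obtain i where i: "dist (x i) c < min \<delta> 1"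
    using \<delta>(1) unfolding closure_approachable by (metis imageE min_less_iff_conj zero_less_one)
  have comp: "\<bar>x i $ j - c $ j\<bar> \<le> 1" for j
    using component_le_norm_cart[of "x i - c" j] i by (simp add: dist_norm)
  have box: "x i - vec ?r \<in> cbox ?a ?b" "x i + vec ?r \<in> cbox ?a ?b"
    using r comp by (auto simp: mem_box_cart abs_le_iff) (smt (verit) comp field_sum_of_halves)+
  have "norm (integral (cbox (x i - vec ?r) (x i + vec ?r)) f - integral (ks_cube l c) f)
      < norm (integral (ks_cube l c) f)"
    using \<delta>(2)[OF box] i by (simp add: dist_norm ks_cube_def)
  moreover have "integral (cbox (x i - vec ?r) (x i + vec ?r)) f = ks_coef x f (prod_encode (l, i))"
    unfolding ks_coef_eq set_lebesgue_integral_eq_integral(2)[OF ks_set_integrable[OF f]]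
    by (simp add: ks_cubes_def ks_cube_def)
  ultimately show False
    by (simp add: zero)
qed

text \<open>
  At almost every point \<open>y\<close>, the value \<open>f y\<close> is the limit of the averages of \<open>f\<close> over the cubes
  with lower corner \<open>y\<close>. For the edges \<open>ks_edge l\<close>, which become arbitrarily small, these
  averages vanish.
\<close>

lemma AE_eq_0_if_ks_coef_eq_0:
  fixes f :: "real ^ 'n::finite \<Rightarrow> complex"
  assumes x: "range x = rational_points" and f: "f \<in> L1_plus_Linf"
    and zero: "\<And>k. ks_coef x f k = 0"
  shows "AE y in lebesgue. f y = 0"
proof -
  have "f integrable_on cbox a b" for a b
    using L1_plus_Linf_set_integrable[OF f lmeasurable_cbox] by (rule set_lebesgue_integral_eq_integral)
  then obtain N where N: "negligible N"
    "\<And>y e. \<lbrakk>y \<notin> N; 0 < e\<rbrakk> \<Longrightarrow> \<exists>d>0. \<forall>h. 0 < h \<and> h < d \<longrightarrow>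
       norm (integral (cbox y (y + h *\<^sub>R One)) f /\<^sub>R h ^ DIM(real ^ 'n) - f y) < e"
    using integrable_ccontinuous_explicit[of f] by blast
  have "f y = 0" if y: "y \<notin> N" for y
  proof (rule ccontr)
    assume "f y \<noteq> 0"
    then obtain d where d: "d > 0" "\<And>h. 0 < h \<Longrightarrow> h < d \<Longrightarrow>
       norm (integral (cbox y (y + h *\<^sub>R One)) f /\<^sub>R h ^ DIM(real ^ 'n) - f y) < norm (f y)"
      using N(2)[OF y, of "norm (f y)"] by auto
    obtain l where l: "ks_edge TYPE('n) l < d"
      using order_tendstoD(2)[OF ks_edge_tendsto_0[where 'n = 'n] d(1)]
      by (auto simp: eventually_sequentially)
    let ?e = "ks_edge TYPE('n) l"
    have "One = (vec 1 :: real ^ 'n)"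
      unfolding vec_eq_iff cart_eq_inner_axis[of One] by simp
    then have "cbox y (y + ?e *\<^sub>R One) = ks_cube l (y + vec (?e / 2))"
      by (auto simp: ks_cube_def vec_eq_iff intro!: arg_cong2[where f = cbox])
    then have "integral (cbox y (y + ?e *\<^sub>R One)) f = 0"
      using ks_cube_integral_eq_0[OF x f zero] by simp
    then show False
      using d(2)[OF ks_edge_pos l] by simp
  qed
  then have "{y. f y \<noteq> 0} \<subseteq> N"
    by blast
  then show ?thesis
    using N(1) by (intro AE_I'[of N]) (auto simp: negligible_iff_null_sets)
qed

section \<open>The Kuelbs--Steadman seminorm\<close>

locale ks_space = prob_weight t for t :: "nat \<Rightarrow> real" +
  fixes x :: "nat \<Rightarrow> real ^ 'n::finite"
  assumes range_x: "range x = rational_points"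
begin

abbreviation ks_dist :: "(real ^ 'n \<Rightarrow> complex) \<Rightarrow> (real ^ 'n \<Rightarrow> complex) \<Rightarrow> real" where
  "ks_dist f g \<equiv> ks_norm x t (\<lambda>y. f y - g y)"

lemma ks_norm_nonneg: "f \<in> L1_plus_Linf \<Longrightarrow> 0 \<le> ks_norm x t f"
  by (simp add: ks_norm_eq wnorm_nonneg bounded_ks_coef)

lemma ks_norm_triangle:
  "f \<in> L1_plus_Linf \<Longrightarrow> g \<in> L1_plus_Linf \<Longrightarrow>
    ks_norm x t (\<lambda>y. f y + g y) \<le> ks_norm x t f + ks_norm x t g"
  by (simp add: ks_norm_eq ks_coef_add wnorm_triangle bounded_ks_coef)

lemma ks_norm_scale:
  "f \<in> L1_plus_Linf \<Longrightarrow> ks_norm x t (\<lambda>y. c * f y) = norm c * ks_norm x t f"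
  by (simp add: ks_norm_eq ks_coef_scale wnorm_scale bounded_ks_coef)

lemma ks_norm_zero [simp]: "ks_norm x t (\<lambda>y. 0) = 0"
  by (simp add: ks_norm_def ks_ip_def)

lemma ks_dist_nonneg: "f \<in> L1_plus_Linf \<Longrightarrow> g \<in> L1_plus_Linf \<Longrightarrow> 0 \<le> ks_dist f g"
  by (simp add: ks_norm_nonneg L1_plus_Linf_diff)

lemma ks_dist_commute:
  assumes "f \<in> L1_plus_Linf" "g \<in> L1_plus_Linf"
  shows "ks_dist f g = ks_dist g f"
  using ks_norm_scale[OF L1_plus_Linf_diff[OF assms], of "-1"] by simp

lemma ks_dist_triangle:
  assumes "f \<in> L1_plus_Linf" "g \<in> L1_plus_Linf" "h \<in> L1_plus_Linf"
  shows "ks_dist f h \<le> ks_dist f g + ks_dist g h"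
  using ks_norm_triangle[OF L1_plus_Linf_diff[OF assms(1,2)] L1_plus_Linf_diff[OF assms(2,3)]]
  by simp

lemma ks_norm_diff_le:
  assumes "f \<in> L1_plus_Linf" "g \<in> L1_plus_Linf"
  shows "\<bar>ks_norm x t f - ks_norm x t g\<bar> \<le> ks_dist f g"
  using ks_norm_triangle[OF L1_plus_Linf_diff[OF assms] assms(2)]
    ks_norm_triangle[OF L1_plus_Linf_diff[OF assms(2,1)] assms(1)] ks_dist_commute[OF assms]
  by simp

lemma ks_dist_add:
  assumes "f \<in> L1_plus_Linf" "g \<in> L1_plus_Linf" "f' \<in> L1_plus_Linf" "g' \<in> L1_plus_Linf"
  shows "ks_dist (\<lambda>y. f y + g y) (\<lambda>y. f' y + g' y) \<le> ks_dist f f' + ks_dist g g'"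
  using ks_norm_triangle[OF L1_plus_Linf_diff[OF assms(1,3)] L1_plus_Linf_diff[OF assms(2,4)]]
  by (simp add: algebra_simps)

lemma ks_dist_scale:
  assumes "f \<in> L1_plus_Linf" "g \<in> L1_plus_Linf"
  shows "ks_dist (\<lambda>y. c * f y) (\<lambda>y. c * g y) = norm c * ks_dist f g"
  using ks_norm_scale[OF L1_plus_Linf_diff[OF assms], of c] by (simp add: algebra_simps)

lemma ks_dist_eq_0_iff:
  assumes f: "f \<in> L1_plus_Linf" and g: "g \<in> L1_plus_Linf"
  shows "ks_dist f g = 0 \<longleftrightarrow> (AE y in lebesgue. f y = g y)"
proof
  assume "ks_dist f g = 0"
  then have "ks_coef x (\<lambda>y. f y - g y) k = 0" for k
    using wnorm_eq_0_imp[OF bounded_ks_coef[OF L1_plus_Linf_diff[OF f g]]] by (simp add: ks_norm_eq)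
  then have "AE y in lebesgue. f y - g y = 0"
    by (rule AE_eq_0_if_ks_coef_eq_0[OF range_x L1_plus_Linf_diff[OF f g]])
  then show "AE y in lebesgue. f y = g y"
    by simp
next
  assume AE: "AE y in lebesgue. f y = g y"
  have "ks_coef x f k = ks_coef x g k" for k
    unfolding ks_coef_eq using f g AE ks_cubes_lmeasurable
    by (intro set_lebesgue_integral_cong_AE)
      (auto dest: L1_plus_Linf_measurable fmeasurableD)
  then have "ks_coef x (\<lambda>y. f y - g y) = ks_coef x (\<lambda>y. 0)"
    by (simp add: ks_coef_diff[OF f g] fun_eq_iff ks_coef_def)
  then have "ks_dist f g = ks_norm x t (\<lambda>y. 0)"
    by (simp only: ks_norm_eq)
  then show "ks_dist f g = 0"
    by simp
qed

text \<open>
  Dominated convergence is used twice. For each cube, the integrand is dominated by \<open>\<bar>f\<bar>\<close>,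
  so each coefficient of the difference tends to 0; and all these coefficients share the
  bound for the integrals of \<open>\<bar>f\<bar>\<close> over sets of measure at most 1, so the weighted norm
  of the coefficient sequence tends to 0 as well.
\<close>

lemma ks_dist_truncate_tendsto_0:
  assumes f: "f \<in> L1_plus_Linf"
  shows "(\<lambda>j. ks_dist (truncate j f) f) \<longlonglongrightarrow> 0"
proof -
  note [measurable] = L1_plus_Linf_measurable[OF f] truncate_measurable[OF L1_plus_Linf_measurable[OF f]]
  have U: "truncate j f \<in> L1_plus_Linf" for j
    using Lp_subset_L1_plus_Linf[of 1] truncate_in_Lp[OF L1_plus_Linf_measurable[OF f]] by auto
  have int: "set_integrable lebesgue (ks_cubes x k) (\<lambda>y. norm (f y))" for k
    using ks_set_integrable[OF f] by (rule set_integrable_norm)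
  obtain C where C: "\<And>S. S \<in> lmeasurable \<Longrightarrow> measure lebesgue S \<le> 1 \<Longrightarrow>
    (LINT y:S|lebesgue. norm (f y)) \<le> C"
    using L1_plus_Linf_integral_bound[OF f] by blast
  have "norm (ks_coef x (\<lambda>y. truncate j f y - f y) k) \<le> C" for j k
  proof -
    have "norm (ks_coef x (\<lambda>y. truncate j f y - f y) k)
        \<le> (LINT y:ks_cubes x k|lebesgue. norm (truncate j f y - f y))"
      by (rule norm_ks_coef_le[OF L1_plus_Linf_diff[OF U f]])
    also have "\<dots> \<le> (LINT y:ks_cubes x k|lebesgue. norm (f y))"
      by (rule set_integral_mono[OF set_integrable_norm[OF ks_set_integrable[OF L1_plus_Linf_diff[OF U f]]] int])
        (rule norm_truncate_diff_le)
    also have "\<dots> \<le> C"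
      by (rule C[OF ks_cubes_lmeasurable measure_ks_cubes_le])
    finally show ?thesis .
  qed
  moreover have "(\<lambda>j. ks_coef x (\<lambda>y. truncate j f y - f y) k) \<longlonglongrightarrow> 0" for k
  proof -
    have [measurable]: "ks_cubes x k \<in> sets lebesgue"
      by (rule fmeasurableD[OF ks_cubes_lmeasurable])
    have "(\<lambda>j. LINT y|lebesgue. indicator (ks_cubes x k) y *\<^sub>R (truncate j f y - f y))
        \<longlonglongrightarrow> (LINT y :: real ^ 'n|lebesgue. (0 :: complex))"
    proof (rule integral_dominated_convergence)
      show "integrable lebesgue (\<lambda>y. indicat_real (ks_cubes x k) y *\<^sub>R norm (f y))"
        using int by (simp add: set_integrable_def)
      show "AE y in lebesgue. (\<lambda>j. indicat_real (ks_cubes x k) y *\<^sub>R (truncate j f y - f y)) \<longlonglongrightarrow> 0"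
        using tendsto_scaleR[OF tendsto_const truncate_diff_tendsto_0] by (intro AE_I2) fastforce
      show "AE y in lebesgue. norm (indicat_real (ks_cubes x k) y *\<^sub>R (truncate j f y - f y))
          \<le> indicat_real (ks_cubes x k) y *\<^sub>R norm (f y)" for j
        using norm_truncate_diff_le[of j f] by (intro AE_I2) (simp add: indicator_def)
    qed measurable
    then show ?thesis
      by (simp add: ks_coef_eq set_lebesgue_integral_def)
  qed
  ultimately show ?thesis
    unfolding ks_norm_eq by (rule wnorm_tendsto_0[rotated])
qed

section \<open>Classes of Cauchy sequences\<close>

lemma Lp_1_L1_plus_Linf: "f \<in> Lp 1 \<Longrightarrow> f \<in> L1_plus_Linf"
  using Lp_subset_L1_plus_Linf[of 1] by auto

lemma ks_Cauchy_in_Lp_1: "u \<in> ks_Cauchy x t \<Longrightarrow> u j \<in> Lp 1"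
  by (simp add: ks_Cauchy_def)

lemma ks_Cauchy_L1_plus_Linf: "u \<in> ks_Cauchy x t \<Longrightarrow> u j \<in> L1_plus_Linf"
  by (simp add: ks_Cauchy_in_Lp_1 Lp_1_L1_plus_Linf)

lemma ks_CauchyD:
  "u \<in> ks_Cauchy x t \<Longrightarrow> 0 < e \<Longrightarrow> \<exists>N. \<forall>i\<ge>N. \<forall>j\<ge>N. ks_dist (u i) (u j) < e"
  by (simp add: ks_Cauchy_def)

lemma ks_Cauchy_if_convergent:
  assumes u: "\<And>j. u j \<in> Lp 1" and f: "f \<in> L1_plus_Linf"
    and lim: "(\<lambda>j. ks_dist (u j) f) \<longlonglongrightarrow> 0"
  shows "u \<in> ks_Cauchy x t"
  unfolding ks_Cauchy_def
proof (intro CollectI conjI allI impI u)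
  fix e :: real
  assume "0 < e"
  then obtain N where N: "\<And>j. j \<ge> N \<Longrightarrow> ks_dist (u j) f < e / 2"
    using order_tendstoD(2)[OF lim, of "e / 2"] by (auto simp: eventually_sequentially)
  have "ks_dist (u i) (u j) < e" if "i \<ge> N" "j \<ge> N" for i j
    using ks_dist_triangle[of "u i" f "u j"] ks_dist_commute[of "u j" f] N[OF that(1)] N[OF that(2)]
      Lp_1_L1_plus_Linf[OF u] f by fastforce
  then show "\<exists>N. \<forall>i\<ge>N. \<forall>j\<ge>N. ks_dist (u i) (u j) < e"
    by blast
qed

lemma ks_Cauchy_const: "f \<in> Lp 1 \<Longrightarrow> (\<lambda>j. f) \<in> ks_Cauchy x t"
  by (rule ks_Cauchy_if_convergent[where f = f]) (auto simp: Lp_1_L1_plus_Linf)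

lemma ks_Cauchy_add:
  assumes u: "u \<in> ks_Cauchy x t" and v: "v \<in> ks_Cauchy x t"
  shows "(\<lambda>j y. u j y + v j y) \<in> ks_Cauchy x t"
  unfolding ks_Cauchy_def
proof (intro CollectI conjI allI impI)
  show "(\<lambda>y. u j y + v j y) \<in> Lp 1" for j
    using u v by (simp add: Lp_add ks_Cauchy_in_Lp_1)
  fix e :: real
  assume "0 < e"
  then obtain M N where M: "\<forall>i\<ge>M. \<forall>j\<ge>M. ks_dist (u i) (u j) < e / 2"
    and N: "\<forall>i\<ge>N. \<forall>j\<ge>N. ks_dist (v i) (v j) < e / 2"
    using ks_CauchyD[OF u, of "e / 2"] ks_CauchyD[OF v, of "e / 2"] by auto
  have "ks_dist (\<lambda>y. u i y + v i y) (\<lambda>y. u j y + v j y) < e" if "i \<ge> max M N" "j \<ge> max M N" for i j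
  proof -
    have "ks_dist (u i) (u j) < e / 2" "ks_dist (v i) (v j) < e / 2"
      using M N that by auto
    then show ?thesis
      using ks_dist_add[of "u i" "v i" "u j" "v j"] ks_Cauchy_L1_plus_Linf[OF u]
        ks_Cauchy_L1_plus_Linf[OF v] by fastforce
  qed
  then show "\<exists>N. \<forall>i\<ge>N. \<forall>j\<ge>N. ks_dist (\<lambda>y. u i y + v i y) (\<lambda>y. u j y + v j y) < e"
    by blast
qed

lemma ks_Cauchy_scale:
  assumes u: "u \<in> ks_Cauchy x t"
  shows "(\<lambda>j y. c * u j y) \<in> ks_Cauchy x t"
  unfolding ks_Cauchy_def
proof (intro CollectI conjI allI impI)
  show "(\<lambda>y. c * u j y) \<in> Lp 1" for j
    using u by (simp add: Lp_scale ks_Cauchy_in_Lp_1)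
  fix e :: real
  assume e: "0 < e"
  \<comment> \<open>Adding 1 to the modulus of \<open>c\<close> makes the division meaningful for \<open>c = 0\<close>.\<close>
  have pos: "0 < norm c + 1"
    by (simp add: add_nonneg_pos)
  obtain N where N: "\<forall>i\<ge>N. \<forall>j\<ge>N. ks_dist (u i) (u j) < e / (norm c + 1)"
    using ks_CauchyD[OF u divide_pos_pos[OF e pos]] by blast
  have "ks_dist (\<lambda>y. c * u i y) (\<lambda>y. c * u j y) < e" if "i \<ge> N" "j \<ge> N" for i j
  proof -
    have nonneg: "0 \<le> ks_dist (u i) (u j)"
      using u by (simp add: ks_dist_nonneg ks_Cauchy_L1_plus_Linf)
    have "norm c * ks_dist (u i) (u j) \<le> (norm c + 1) * ks_dist (u i) (u j)"
      using nonneg by (intro mult_right_mono) auto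
    also have "\<dots> < e"
      using N that pos by (simp add: pos_less_divide_eq mult.commute)
    finally show ?thesis
      using u by (simp add: ks_dist_scale ks_Cauchy_L1_plus_Linf)
  qed
  then show "\<exists>N. \<forall>i\<ge>N. \<forall>j\<ge>N. ks_dist (\<lambda>y. c * u i y) (\<lambda>y. c * u j y) < e"
    by blast
qed

lemma ks_rel_iff:
  "(u, v) \<in> ks_rel x t \<longleftrightarrow> u \<in> ks_Cauchy x t \<and> v \<in> ks_Cauchy x t \<and>
     (\<lambda>j. ks_dist (u j) (v j)) \<longlonglongrightarrow> 0"
  by (simp add: ks_rel_def)

lemma ks_dist_tendsto_0_trans:
  assumes "\<And>j. u j \<in> L1_plus_Linf" "\<And>j. v j \<in> L1_plus_Linf" "\<And>j. w j \<in> L1_plus_Linf"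
    and "(\<lambda>j. ks_dist (u j) (v j)) \<longlonglongrightarrow> 0" "(\<lambda>j. ks_dist (v j) (w j)) \<longlonglongrightarrow> 0"
  shows "(\<lambda>j. ks_dist (u j) (w j)) \<longlonglongrightarrow> 0"
proof (rule real_tendsto_sandwich)
  show "\<forall>\<^sub>F j in sequentially. 0 \<le> ks_dist (u j) (w j)"
    using assms by (simp add: ks_dist_nonneg)
  show "\<forall>\<^sub>F j in sequentially. ks_dist (u j) (w j) \<le> ks_dist (u j) (v j) + ks_dist (v j) (w j)"
    using assms by (simp add: ks_dist_triangle)
  show "(\<lambda>j. ks_dist (u j) (v j) + ks_dist (v j) (w j)) \<longlonglongrightarrow> 0"
    using tendsto_add[OF assms(4,5)] by simp
qed simp

lemma ks_dist_tendsto_0_sym: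
  assumes "\<And>j. u j \<in> L1_plus_Linf" "\<And>j. v j \<in> L1_plus_Linf"
    and "(\<lambda>j. ks_dist (u j) (v j)) \<longlonglongrightarrow> 0"
  shows "(\<lambda>j. ks_dist (v j) (u j)) \<longlonglongrightarrow> 0"
  using assms(3) unfolding ks_dist_commute[OF assms(1,2)] .

lemma equiv_ks_rel: "equiv (ks_Cauchy x t) (ks_rel x t)"
proof (rule equivI)
  show "ks_rel x t \<subseteq> ks_Cauchy x t \<times> ks_Cauchy x t"
    by (auto simp: ks_rel_iff)
  show "refl_on (ks_Cauchy x t) (ks_rel x t)"
    by (auto simp: refl_on_def ks_rel_iff)
  show "sym (ks_rel x t)"
    by (auto simp: sym_def ks_rel_iff intro: ks_dist_tendsto_0_sym ks_Cauchy_L1_plus_Linf)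
  show "trans (ks_rel x t)"
    by (auto simp: trans_def ks_rel_iff intro: ks_dist_tendsto_0_trans ks_Cauchy_L1_plus_Linf)
qed

lemma ks_rel_add:
  assumes "(u, u') \<in> ks_rel x t" "(v, v') \<in> ks_rel x t"
  shows "((\<lambda>j y. u j y + v j y), (\<lambda>j y. u' j y + v' j y)) \<in> ks_rel x t"
proof -
  have C: "u \<in> ks_Cauchy x t" "u' \<in> ks_Cauchy x t" "v \<in> ks_Cauchy x t" "v' \<in> ks_Cauchy x t"
    using assms by (auto simp: ks_rel_iff)
  have "(\<lambda>j. ks_dist (\<lambda>y. u j y + v j y) (\<lambda>y. u' j y + v' j y)) \<longlonglongrightarrow> 0"
  proof (rule real_tendsto_sandwich)
    show "\<forall>\<^sub>F j in sequentially. 0 \<le> ks_dist (\<lambda>y. u j y + v j y) (\<lambda>y. u' j y + v' j y)"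
      using C by (simp add: ks_dist_nonneg L1_plus_Linf_add ks_Cauchy_L1_plus_Linf)
    show "\<forall>\<^sub>F j in sequentially. ks_dist (\<lambda>y. u j y + v j y) (\<lambda>y. u' j y + v' j y)
        \<le> ks_dist (u j) (u' j) + ks_dist (v j) (v' j)"
      using C by (simp add: ks_dist_add ks_Cauchy_L1_plus_Linf)
    show "(\<lambda>j. ks_dist (u j) (u' j) + ks_dist (v j) (v' j)) \<longlonglongrightarrow> 0"
      using assms tendsto_add by (fastforce simp: ks_rel_iff)
  qed simp
  then show ?thesis
    using C by (simp add: ks_rel_iff ks_Cauchy_add)
qed

lemma ks_rel_scale:
  assumes "(u, u') \<in> ks_rel x t"
  shows "((\<lambda>j y. c * u j y), (\<lambda>j y. c * u' j y)) \<in> ks_rel x t"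
proof -
  have C: "u \<in> ks_Cauchy x t" "u' \<in> ks_Cauchy x t"
    using assms by (auto simp: ks_rel_iff)
  have "(\<lambda>j. norm c * ks_dist (u j) (u' j)) \<longlonglongrightarrow> 0"
    using assms tendsto_mult_right_zero by (auto simp: ks_rel_iff)
  then show ?thesis
    using C by (simp add: ks_rel_iff ks_Cauchy_scale ks_dist_scale ks_Cauchy_L1_plus_Linf)
qed

lemma ks_class_self: "u \<in> ks_Cauchy x t \<Longrightarrow> u \<in> ks_rel x t `` {u}"
  by (rule equiv_class_self[OF equiv_ks_rel])

text \<open>
  The definition of \<open>ks_add\<close> is a union over all pairs of representatives. By
  \<open>ks_rel_add\<close> all members of that union are the same class, and the union is not empty.
\<close>

lemma ks_add_classes:
  assumes u: "u \<in> ks_Cauchy x t" and v: "v \<in> ks_Cauchy x t"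
  shows "ks_add x t (ks_rel x t `` {u}) (ks_rel x t `` {v}) = ks_rel x t `` {\<lambda>j y. u j y + v j y}"
proof -
  have "ks_rel x t `` {\<lambda>j y. u' j y + v' j y} = ks_rel x t `` {\<lambda>j y. u j y + v j y}"
    if "u' \<in> ks_rel x t `` {u}" "v' \<in> ks_rel x t `` {v}" for u' v'
    using that by (intro equiv_class_eq[OF equiv_ks_rel, symmetric] ks_rel_add) auto
  then show ?thesis
    using ks_class_self[OF u] ks_class_self[OF v] unfolding ks_add_def by blast
qed

lemma ks_scale_class:
  assumes u: "u \<in> ks_Cauchy x t"
  shows "ks_scale x t c (ks_rel x t `` {u}) = ks_rel x t `` {\<lambda>j y. c * u j y}"
proof -
  have "ks_rel x t `` {\<lambda>j y. c * u' j y} = ks_rel x t `` {\<lambda>j y. c * u j y}"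
    if "u' \<in> ks_rel x t `` {u}" for u'
    using that by (intro equiv_class_eq[OF equiv_ks_rel, symmetric] ks_rel_scale) auto
  then show ?thesis
    using ks_class_self[OF u] unfolding ks_scale_def by blast
qed

lemma ks_norm_convergent:
  assumes u: "u \<in> ks_Cauchy x t"
  shows "convergent (\<lambda>j. ks_norm x t (u j))"
proof -
  have "Cauchy (\<lambda>j. ks_norm x t (u j))"
  proof (rule metric_CauchyI)
    fix e :: real
    assume "0 < e"
    then obtain N where N: "\<forall>i\<ge>N. \<forall>j\<ge>N. ks_dist (u i) (u j) < e"
      using ks_CauchyD[OF u] by blast
    have "dist (ks_norm x t (u i)) (ks_norm x t (u j)) < e" if "i \<ge> N" "j \<ge> N" for i j
      using ks_norm_diff_le[OF ks_Cauchy_L1_plus_Linf[OF u] ks_Cauchy_L1_plus_Linf[OF u], of i j] N that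
      by (fastforce simp: dist_real_def)
    then show "\<exists>N. \<forall>i\<ge>N. \<forall>j\<ge>N. dist (ks_norm x t (u i)) (ks_norm x t (u j)) < e"
      by blast
  qed
  then show ?thesis
    by (simp add: Cauchy_convergent_iff)
qed

lemma ks_norm_tendsto_rel:
  assumes uv: "(u, v) \<in> ks_rel x t" and lim: "(\<lambda>j. ks_norm x t (u j)) \<longlonglongrightarrow> d"
  shows "(\<lambda>j. ks_norm x t (v j)) \<longlonglongrightarrow> d"
proof (rule Lim_transform2[OF lim])
  show "(\<lambda>j. ks_norm x t (u j) - ks_norm x t (v j)) \<longlonglongrightarrow> 0"
  proof (rule Lim_null_comparison)
    show "\<forall>\<^sub>F j in sequentially. norm (ks_norm x t (u j) - ks_norm x t (v j)) \<le> ks_dist (u j) (v j)"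
      using uv by (simp add: ks_rel_iff ks_norm_diff_le ks_Cauchy_L1_plus_Linf)
    show "(\<lambda>j. ks_dist (u j) (v j)) \<longlonglongrightarrow> 0"
      using uv by (simp add: ks_rel_iff)
  qed
qed

text \<open>
  Two representatives \<open>u\<close> and \<open>v\<close> of one class satisfy
  \<open>(u, v) = \<parallel>u\<parallel>\<^sup>2 - (u, u - v)\<close>, and by Cauchy--Schwarz the last term
  tends to 0 because the norms of \<open>u\<close> are bounded.
\<close>

lemma ks_ip_tendsto:
  assumes uv: "(u, v) \<in> ks_rel x t" and lim: "(\<lambda>j. ks_norm x t (u j)) \<longlonglongrightarrow> d"
  shows "(\<lambda>j. ks_ip x t (u j) (v j)) \<longlonglongrightarrow> of_real (d\<^sup>2)"
proof -
  have U: "u j \<in> L1_plus_Linf" "v j \<in> L1_plus_Linf" for j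
    using uv by (auto simp: ks_rel_iff ks_Cauchy_L1_plus_Linf)
  note b = bounded_ks_coef[OF U(1)] bounded_ks_coef[OF U(2)]
  have self: "ks_ip x t (u j) (u j) = of_real ((ks_norm x t (u j))\<^sup>2)" for j
    unfolding ks_ip_eq ks_norm_eq by (rule wip_self[OF b(1)])
  have diff: "ks_ip x t (u j) (u j) - ks_ip x t (u j) (v j) = ks_ip x t (u j) (\<lambda>y. u j y - v j y)" for j
    unfolding ks_ip_eq ks_coef_diff[OF U] by (rule wip_diff_right[OF b(1) b, symmetric])
  have "(\<lambda>j. ks_ip x t (u j) (u j)) \<longlonglongrightarrow> of_real (d\<^sup>2)"
    unfolding self by (intro tendsto_intros lim)
  moreover have "(\<lambda>j. ks_ip x t (u j) (u j) - ks_ip x t (u j) (v j)) \<longlonglongrightarrow> 0"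
  proof (rule Lim_null_comparison)
    have "norm (ks_ip x t (u j) (\<lambda>y. u j y - v j y)) \<le> ks_norm x t (u j) * ks_dist (u j) (v j)" for j
      unfolding ks_ip_eq ks_norm_eq
      by (rule wip_Cauchy_Schwarz[OF b(1) bounded_ks_coef[OF L1_plus_Linf_diff[OF U]]])
    then show "\<forall>\<^sub>F j in sequentially. norm (ks_ip x t (u j) (u j) - ks_ip x t (u j) (v j))
        \<le> ks_norm x t (u j) * ks_dist (u j) (v j)"
      by (simp add: diff)
    show "(\<lambda>j. ks_norm x t (u j) * ks_dist (u j) (v j)) \<longlonglongrightarrow> 0"
      using tendsto_mult[OF lim] uv by (fastforce simp: ks_rel_iff)
  qed
  ultimately show ?thesis
    by (rule Lim_transform2)
qed

lemma KS2_ip_self: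
  assumes w: "w \<in> ks_Cauchy x t" and lim: "(\<lambda>j. ks_norm x t (w j)) \<longlonglongrightarrow> d"
  shows "KS2_ip x t (ks_rel x t `` {w}) (ks_rel x t `` {w}) = of_real (d\<^sup>2)"
  unfolding KS2_ip_def
proof (rule the_equality)
  show "\<forall>u\<in>ks_rel x t `` {w}. \<forall>v\<in>ks_rel x t `` {w}.
      (\<lambda>j. ks_ip x t (u j) (v j)) \<longlonglongrightarrow> of_real (d\<^sup>2)"
  proof (intro ballI)
    fix u v
    assume "u \<in> ks_rel x t `` {w}" "v \<in> ks_rel x t `` {w}"
    then have wu: "(w, u) \<in> ks_rel x t" and wv: "(w, v) \<in> ks_rel x t"
      by auto
    have "(u, v) \<in> ks_rel x t"
      using wu wv equiv_ks_rel by (meson equivE symD transD)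
    then show "(\<lambda>j. ks_ip x t (u j) (v j)) \<longlonglongrightarrow> of_real (d\<^sup>2)"
      using ks_norm_tendsto_rel[OF wu lim] by (rule ks_ip_tendsto)
  qed
  then show "c = of_real (d\<^sup>2)"
    if "\<forall>u\<in>ks_rel x t `` {w}. \<forall>v\<in>ks_rel x t `` {w}. (\<lambda>j. ks_ip x t (u j) (v j)) \<longlonglongrightarrow> c" for c
    using that ks_class_self[OF w] LIMSEQ_unique by blast
qed

text \<open>
  Together with \<open>ks_norm_convergent\<close>, this computes distances in the completion without
  reference to its inner product.
\<close>

lemma KS2_dist_classes:
  assumes u: "u \<in> ks_Cauchy x t" and v: "v \<in> ks_Cauchy x t"
    and lim: "(\<lambda>j. ks_dist (u j) (v j)) \<longlonglongrightarrow> d"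
  shows "KS2_dist x t (ks_rel x t `` {u}) (ks_rel x t `` {v}) = d"
proof -
  have w: "(\<lambda>j y. u j y + -1 * v j y) \<in> ks_Cauchy x t"
    using u v by (intro ks_Cauchy_add ks_Cauchy_scale)
  have "KS2_ip x t (ks_rel x t `` {\<lambda>j y. u j y + -1 * v j y}) (ks_rel x t `` {\<lambda>j y. u j y + -1 * v j y})
      = of_real (d\<^sup>2)"
    by (rule KS2_ip_self[OF w]) (use lim in simp)
  moreover have "0 \<le> d"
    using lim by (rule LIMSEQ_le_const)
      (use u v in \<open>auto simp: ks_dist_nonneg ks_Cauchy_L1_plus_Linf\<close>)
  ultimately show ?thesis
    by (simp only: KS2_dist_def Let_def ks_scale_class[OF v] ks_add_classes[OF u ks_Cauchy_scale[OF v]])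
      simp
qed

section \<open>The embedding\<close>

text \<open>
  By the triangle inequality, a Cauchy sequence converges to \<open>f\<close> iff its distance to some
  sequence converging to \<open>f\<close> tends to 0. All identities about \<open>ks_embed\<close> thereby reduce to
  exhibiting one member.
\<close>

lemma ks_embed_eq_class:
  assumes f: "f \<in> L1_plus_Linf" and u: "u \<in> ks_embed x t f"
  shows "ks_embed x t f = ks_rel x t `` {u}"
proof -
  have uC: "u \<in> ks_Cauchy x t" and lim: "(\<lambda>j. ks_dist (u j) f) \<longlonglongrightarrow> 0"
    using u by (auto simp: ks_embed_def)
  have "(\<lambda>j. ks_dist (v j) f) \<longlonglongrightarrow> 0 \<longleftrightarrow> (\<lambda>j. ks_dist (u j) (v j)) \<longlonglongrightarrow> 0"
    if v: "v \<in> ks_Cauchy x t" for v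
  proof
    assume "(\<lambda>j. ks_dist (v j) f) \<longlonglongrightarrow> 0"
    then have "(\<lambda>j. ks_dist f (v j)) \<longlonglongrightarrow> 0"
      using f v by (intro ks_dist_tendsto_0_sym[of v]) (simp_all add: ks_Cauchy_L1_plus_Linf)
    then show "(\<lambda>j. ks_dist (u j) (v j)) \<longlonglongrightarrow> 0"
      using ks_dist_tendsto_0_trans[of u "\<lambda>j. f" v] lim f uC v by (simp add: ks_Cauchy_L1_plus_Linf)
  next
    assume "(\<lambda>j. ks_dist (u j) (v j)) \<longlonglongrightarrow> 0"
    then have "(\<lambda>j. ks_dist (v j) (u j)) \<longlonglongrightarrow> 0"
      using uC v by (intro ks_dist_tendsto_0_sym[of u]) (simp_all add: ks_Cauchy_L1_plus_Linf)
    then show "(\<lambda>j. ks_dist (v j) f) \<longlonglongrightarrow> 0"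
      using ks_dist_tendsto_0_trans[of v u "\<lambda>j. f"] lim f uC v by (simp add: ks_Cauchy_L1_plus_Linf)
  qed
  then show ?thesis
    using uC by (auto simp: ks_embed_def ks_rel_iff)
qed

lemma truncate_in_ks_embed:
  assumes f: "f \<in> L1_plus_Linf"
  shows "(\<lambda>j. truncate j f) \<in> ks_embed x t f"
  using ks_dist_truncate_tendsto_0[OF f] truncate_in_Lp[OF L1_plus_Linf_measurable[OF f]]
  by (auto simp: ks_embed_def intro: ks_Cauchy_if_convergent[OF _ f])

lemma ks_embedE:
  assumes "f \<in> L1_plus_Linf"
  obtains u where "u \<in> ks_Cauchy x t" "u \<in> ks_embed x t f" "ks_embed x t f = ks_rel x t `` {u}"
  using truncate_in_ks_embed[OF assms] ks_embed_eq_class[OF assms] by (auto simp: ks_embed_def)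

lemma ks_embed_in_KS2: "f \<in> L1_plus_Linf \<Longrightarrow> ks_embed x t f \<in> KS2 x t"
  by (erule ks_embedE) (simp add: KS2_def quotientI)

text \<open>
  A common member of the two classes converges to both functions, which are then at distance 0.
\<close>

lemma ks_embed_eq_iff:
  assumes f: "f \<in> L1_plus_Linf" and g: "g \<in> L1_plus_Linf"
  shows "ks_embed x t f = ks_embed x t g \<longleftrightarrow> (AE y in lebesgue. f y = g y)"
proof
  assume eq: "ks_embed x t f = ks_embed x t g"
  obtain u where u: "u \<in> ks_embed x t f"
    using truncate_in_ks_embed[OF f] by blast
  then have U: "u j \<in> L1_plus_Linf" for j
    by (auto simp: ks_embed_def ks_Cauchy_L1_plus_Linf)
  have "(\<lambda>j. ks_dist (u j) f) \<longlonglongrightarrow> 0" "(\<lambda>j. ks_dist (u j) g) \<longlonglongrightarrow> 0"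
    using u eq by (auto simp: ks_embed_def)
  then have "(\<lambda>j. ks_dist f g) \<longlonglongrightarrow> 0"
    using ks_dist_tendsto_0_trans[of "\<lambda>j. f" u "\<lambda>j. g"] f g U ks_dist_commute[OF f U] by simp
  then show "AE y in lebesgue. f y = g y"
    using ks_dist_eq_0_iff[OF f g] by (simp add: LIMSEQ_const_iff)
next
  assume "AE y in lebesgue. f y = g y"
  then have fg: "ks_dist f g = 0" "ks_dist g f = 0"
    using ks_dist_eq_0_iff[OF f g] ks_dist_commute[OF f g] by auto
  have "(\<lambda>j. ks_dist (u j) f) \<longlonglongrightarrow> 0 \<longleftrightarrow> (\<lambda>j. ks_dist (u j) g) \<longlonglongrightarrow> 0" if "u \<in> ks_Cauchy x t" for u
  proof -
    have U: "u j \<in> L1_plus_Linf" for j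
      using that by (rule ks_Cauchy_L1_plus_Linf)
    have "ks_dist (u j) f = ks_dist (u j) g" for j
      using ks_dist_triangle[OF U f g] ks_dist_triangle[OF U g f] fg by (simp add: antisym)
    then show ?thesis
      by simp
  qed
  then show "ks_embed x t f = ks_embed x t g"
    by (auto simp: ks_embed_def)
qed

lemma ks_embed_eq_const:
  assumes f: "f \<in> Lp 1"
  shows "ks_embed x t f = ks_const x t f"
  unfolding ks_const_def
  using f by (intro ks_embed_eq_class) (auto simp: ks_embed_def ks_Cauchy_const Lp_1_L1_plus_Linf)

lemma ks_embed_add:
  assumes f: "f \<in> L1_plus_Linf" and g: "g \<in> L1_plus_Linf"
  shows "ks_embed x t (\<lambda>y. f y + g y) = ks_add x t (ks_embed x t f) (ks_embed x t g)"
proof -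
  obtain u where u: "u \<in> ks_Cauchy x t" "u \<in> ks_embed x t f" "ks_embed x t f = ks_rel x t `` {u}"
    using ks_embedE[OF f] .
  obtain v where v: "v \<in> ks_Cauchy x t" "v \<in> ks_embed x t g" "ks_embed x t g = ks_rel x t `` {v}"
    using ks_embedE[OF g] .
  have U: "u j \<in> L1_plus_Linf" "v j \<in> L1_plus_Linf" for j
    using u(1) v(1) by (auto simp: ks_Cauchy_L1_plus_Linf)
  have "(\<lambda>j. ks_dist (\<lambda>y. u j y + v j y) (\<lambda>y. f y + g y)) \<longlonglongrightarrow> 0"
  proof (rule real_tendsto_sandwich)
    show "\<forall>\<^sub>F j in sequentially. 0 \<le> ks_dist (\<lambda>y. u j y + v j y) (\<lambda>y. f y + g y)"
      using U f g by (simp add: ks_dist_nonneg L1_plus_Linf_add)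
    show "\<forall>\<^sub>F j in sequentially. ks_dist (\<lambda>y. u j y + v j y) (\<lambda>y. f y + g y)
        \<le> ks_dist (u j) f + ks_dist (v j) g"
      using U f g by (simp add: ks_dist_add)
    show "(\<lambda>j. ks_dist (u j) f + ks_dist (v j) g) \<longlonglongrightarrow> 0"
      using u(2) v(2) tendsto_add by (fastforce simp: ks_embed_def)
  qed simp
  then have "(\<lambda>j y. u j y + v j y) \<in> ks_embed x t (\<lambda>y. f y + g y)"
    using u(1) v(1) by (simp add: ks_embed_def ks_Cauchy_add)
  then show ?thesis
    using ks_embed_eq_class[OF L1_plus_Linf_add[OF f g]] ks_add_classes[OF u(1) v(1)]
    by (simp add: u(3) v(3))
qed

lemma ks_embed_scale:
  assumes f: "f \<in> L1_plus_Linf"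
  shows "ks_embed x t (\<lambda>y. c * f y) = ks_scale x t c (ks_embed x t f)"
proof -
  obtain u where u: "u \<in> ks_Cauchy x t" "u \<in> ks_embed x t f" "ks_embed x t f = ks_rel x t `` {u}"
    using ks_embedE[OF f] .
  have "(\<lambda>j. norm c * ks_dist (u j) f) \<longlonglongrightarrow> 0"
    using u(2) tendsto_mult_right_zero by (auto simp: ks_embed_def)
  then have "(\<lambda>j y. c * u j y) \<in> ks_embed x t (\<lambda>y. c * f y)"
    using u(1) f by (simp add: ks_embed_def ks_Cauchy_scale ks_dist_scale ks_Cauchy_L1_plus_Linf)
  then show ?thesis
    using ks_embed_eq_class[OF L1_plus_Linf_scale[OF f]] ks_scale_class[OF u(1)]
    by (simp add: u(3))
qed

lemma KS2_subspace_embed_Lp: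
  assumes p: "1 \<le> p"
  shows "KS2_subspace x t (ks_embed x t ` Lp p)"
proof -
  have U: "f \<in> L1_plus_Linf" if "f \<in> Lp p" for f :: "real ^ 'n \<Rightarrow> complex"
    using Lp_subset_L1_plus_Linf[OF p] that by auto
  have "ks_zero x t = ks_embed x t (\<lambda>y. 0)"
    using ks_embed_eq_const[OF Lp_zero] by (simp add: ks_zero_def ks_const_def)
  then have "ks_zero x t \<in> ks_embed x t ` Lp p"
    using Lp_zero by blast
  moreover have "ks_add x t X Y \<in> ks_embed x t ` Lp p"
    if "X \<in> ks_embed x t ` Lp p" "Y \<in> ks_embed x t ` Lp p" for X Y
    using that by (auto simp: U simp flip: ks_embed_add intro!: imageI Lp_add[OF p])
  moreover have "ks_scale x t c X \<in> ks_embed x t ` Lp p" if "X \<in> ks_embed x t ` Lp p" for c X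
    using that by (auto simp: U simp flip: ks_embed_scale intro!: imageI Lp_scale)
  ultimately show ?thesis
    by (auto simp: KS2_subspace_def U ks_embed_in_KS2)
qed

text \<open>
  An element of the completion is close to a late member \<open>u N\<close> of any of its representatives,
  and \<open>u N\<close> is close to a truncation of itself. That truncation lies in \<open>L\<^sup>1\<close> as well as in
  \<open>L\<^sup>p\<close>, so its embedding is the class of a constant sequence and the distance is a limit of
  seminorms.
\<close>

lemma KS2_dense_embed_Lp: "KS2_dense x t (ks_embed x t ` Lp p)"
  unfolding KS2_dense_def
proof (intro ballI allI impI)
  fix X and e :: real
  assume "X \<in> KS2 x t" and e: "0 < e"
  then obtain u where u: "u \<in> ks_Cauchy x t" and X: "X = ks_rel x t `` {u}"
    by (auto simp: KS2_def elim: quotientE)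
  obtain N where N: "\<forall>i\<ge>N. \<forall>j\<ge>N. ks_dist (u i) (u j) < e / 3"
    using ks_CauchyD[OF u, of "e / 3"] e by auto
  have uN: "u N \<in> L1_plus_Linf"
    using u by (rule ks_Cauchy_L1_plus_Linf)
  obtain m where m: "ks_dist (truncate m (u N)) (u N) < e / 3"
    using order_tendstoD(2)[OF ks_dist_truncate_tendsto_0[OF uN], of "e / 3"] e
    by (auto simp: eventually_sequentially)
  define g where "g = truncate m (u N)"
  have g: "g \<in> Lp q" for q
    unfolding g_def by (rule truncate_in_Lp[OF L1_plus_Linf_measurable[OF uN]])
  have gU: "g \<in> L1_plus_Linf"
    by (rule Lp_1_L1_plus_Linf[OF g])
  have "convergent (\<lambda>j. ks_norm x t (\<lambda>y. u j y + -1 * g y))"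
    by (rule ks_norm_convergent[OF ks_Cauchy_add[OF u ks_Cauchy_scale[OF ks_Cauchy_const[OF g]]]])
  then obtain d where d: "(\<lambda>j. ks_dist (u j) g) \<longlonglongrightarrow> d"
    by (auto simp: convergent_def)
  have "d \<le> 2 * e / 3"
  proof (rule LIMSEQ_le_const2[OF d], intro exI allI impI)
    fix j
    assume "N \<le> j"
    then have "ks_dist (u j) (u N) < e / 3"
      using N by auto
    moreover have "ks_dist (u j) g \<le> ks_dist (u j) (u N) + ks_dist (u N) g"
      by (rule ks_dist_triangle[OF ks_Cauchy_L1_plus_Linf[OF u] uN gU])
    ultimately show "ks_dist (u j) g \<le> 2 * e / 3"
      using m ks_dist_commute[OF uN gU] by (simp add: g_def)
  qed
  moreover have "KS2_dist x t X (ks_embed x t g) = d"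
    unfolding X ks_embed_eq_const[OF g] ks_const_def
    by (rule KS2_dist_classes[OF u ks_Cauchy_const[OF g] d])
  ultimately have "KS2_dist x t X (ks_embed x t g) < e"
    using e by linarith
  then show "\<exists>Y\<in>ks_embed x t ` Lp p. KS2_dist x t X Y < e"
    using g by blast
qed

end

theorem theorem3p6:
  fixes x :: "nat \<Rightarrow> real ^ 'n::finite" and t :: "nat \<Rightarrow> real" and p :: ennreal
  assumes "bij_betw x UNIV rational_points"
    and "\<And>k. t k > 0" and "t sums 1"
    and "1 \<le> p"
  shows "(\<forall>f\<in>Lp p. \<forall>g\<in>Lp p. ks_embed x t f = ks_embed x t g \<longleftrightarrow> (AE y in lebesgue. f y = g y))
    \<and> (\<forall>f\<in>Lp p \<inter> Lp 1. ks_embed x t f = ks_const x t f)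
    \<and> (\<forall>f\<in>Lp p. \<forall>g\<in>Lp p.
         ks_embed x t (\<lambda>y. f y + g y) = ks_add x t (ks_embed x t f) (ks_embed x t g))
    \<and> (\<forall>c. \<forall>f\<in>Lp p. ks_embed x t (\<lambda>y. c * f y) = ks_scale x t c (ks_embed x t f))
    \<and> KS2_subspace x t (ks_embed x t ` Lp p)
    \<and> KS2_dense x t (ks_embed x t ` Lp p)"
proof -
  interpret ks_space t x
    using assms(1-3) by unfold_locales (auto simp: bij_betw_def)
  have U: "f \<in> L1_plus_Linf" if "f \<in> Lp p" for f :: "real ^ 'n \<Rightarrow> complex"
    using Lp_subset_L1_plus_Linf[OF assms(4)] that by auto
  show ?thesis
    using KS2_subspace_embed_Lp[OF assms(4)] KS2_dense_embed_Lp
    by (simp add: U ks_embed_eq_iff ks_embed_eq_const ks_embed_add ks_embed_scale)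
qed

end
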